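(* Let $Z$ be a topological space. The following statements are equivalent: (i) $Z$ is down-spectral. (ii) $Z$ is a Balbes-Dwinger and compact space. (iii) $Z$ is homeomorphic to the prime spectrum of a distributive lattice with maximum.
   Context: An irreducible closed set is a non-empty closed set $F$ such that $F=G\cup H$ with $G,H$ closed implies $F=G$ or $F=H$. A space $Z$ is almost-sober if every proper irreducible closed set (i.e. one different from $Z$) is the closure of some point. A space is coherent if it has a basis of open compact sets that is closed under finite (non-empty) intersections (compactness does not include Hausdorff). A space is down-spectral if it is $T_0$, coherent, compact and almost-sober. A lattice is a non-empty poset with binary joins and meets (neither a minimum nor a maximum is required in general). An ideal is a non-empty lower subset closed under finite non-empty joins. A proper ideal $I$ is prime if $a\wedge b\in I$ implies $a\in I$ or $b\in I$. The prime spectrum of a lattice $L$ is the set of its prime ideals with the topology whose basic open sets are $d(a)=\{I : I\text{ a prime ideal of }L,\ a\notin I\}$, $a\in L$. A Balbes-Dwinger space is a topological space homeomorphic to the prime spectrum of a distributive (not necessarily bounded) lattice. *)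

theory Defs
  imports "HOL-Analysis.Analysis" "HOL-Algebra.Lattice"
begin

section \<open>Down-spectral spaces\<close>

definition irreducible_closedin :: "'a topology \<Rightarrow> 'a set \<Rightarrow> bool" where
  "irreducible_closedin X F \<longleftrightarrow>
     closedin X F \<and> F \<noteq> {} \<and>
     (\<forall>G H. closedin X G \<longrightarrow> closedin X H \<longrightarrow> F = G \<union> H \<longrightarrow> F = G \<or> F = H)"

definition almost_sober :: "'a topology \<Rightarrow> bool" where
  "almost_sober X \<longleftrightarrow>
     (\<forall>F. irreducible_closedin X F \<longrightarrow> F \<noteq> topspace X \<longrightarrow>
        (\<exists>x\<in>topspace X. F = X closure_of {x}))"

text \<open>The analogue for abstract topologies of \<^const>\<open>topological_basis\<close>.\<close>

definition base_of :: "'a topology \<Rightarrow> 'a set set \<Rightarrow> bool" where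
  "base_of X B \<longleftrightarrow>
     (\<forall>U\<in>B. openin X U) \<and> (\<forall>U. openin X U \<longrightarrow> (\<exists>B'\<subseteq>B. \<Union>B' = U))"

definition coherent_space :: "'a topology \<Rightarrow> bool" where
  "coherent_space X \<longleftrightarrow>
     (\<exists>B. base_of X B \<and> (\<forall>U\<in>B. compactin X U) \<and> (\<forall>U\<in>B. \<forall>V\<in>B. U \<inter> V \<in> B))"

definition down_spectral :: "'a topology \<Rightarrow> bool" where
  "down_spectral X \<longleftrightarrow>
     t0_space X \<and> coherent_space X \<and> compact_space X \<and> almost_sober X"

section \<open>Prime spectra of distributive lattices\<close>

text \<open>The locale \<^locale>\<open>lattice\<close> does not require bounds, but it does allow an empty carrier.\<close>

definition distributive_lattice :: "('b, 'm) gorder_scheme \<Rightarrow> bool" where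
  "distributive_lattice L \<longleftrightarrow>
     lattice L \<and> carrier L \<noteq> {} \<and>
     (\<forall>x\<in>carrier L. \<forall>y\<in>carrier L. \<forall>z\<in>carrier L.
        x \<sqinter>\<^bsub>L\<^esub> (y \<squnion>\<^bsub>L\<^esub> z) = (x \<sqinter>\<^bsub>L\<^esub> y) \<squnion>\<^bsub>L\<^esub> (x \<sqinter>\<^bsub>L\<^esub> z))"

definition lattice_ideal :: "('b, 'm) gorder_scheme \<Rightarrow> 'b set \<Rightarrow> bool" where
  "lattice_ideal L I \<longleftrightarrow>
     I \<subseteq> carrier L \<and> I \<noteq> {} \<and>
     (\<forall>a\<in>I. \<forall>b\<in>carrier L. b \<sqsubseteq>\<^bsub>L\<^esub> a \<longrightarrow> b \<in> I) \<and>
     (\<forall>a\<in>I. \<forall>b\<in>I. a \<squnion>\<^bsub>L\<^esub> b \<in> I)"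

definition lattice_prime_ideal :: "('b, 'm) gorder_scheme \<Rightarrow> 'b set \<Rightarrow> bool" where
  "lattice_prime_ideal L I \<longleftrightarrow>
     lattice_ideal L I \<and> I \<noteq> carrier L \<and>
     (\<forall>a\<in>carrier L. \<forall>b\<in>carrier L. a \<sqinter>\<^bsub>L\<^esub> b \<in> I \<longrightarrow> a \<in> I \<or> b \<in> I)"

definition spectrum_basic_open :: "('b, 'm) gorder_scheme \<Rightarrow> 'b \<Rightarrow> 'b set set" where
  "spectrum_basic_open L a = {I. lattice_prime_ideal L I \<and> a \<notin> I}"

text \<open>
  Generating a topology a priori only makes the sets \<^term>\<open>spectrum_basic_open L a\<close> a subbase;
  that they are a base of a topology on the set of all prime ideals is shown in
  \<open>base_of_prime_spectrum\<close> and \<open>topspace_prime_spectrum\<close> below.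
\<close>

definition prime_spectrum :: "('b, 'm) gorder_scheme \<Rightarrow> 'b set topology" where
  "prime_spectrum L = topology_generated_by (spectrum_basic_open L ` carrier L)"

lemma topspace_prime_spectrum:
  "topspace (prime_spectrum L) = {I. lattice_prime_ideal L I}"
proof -
  have "\<exists>a\<in>carrier L. a \<notin> I" if "lattice_prime_ideal L I" for I
    using that unfolding lattice_prime_ideal_def lattice_ideal_def by blast
  then show ?thesis
    unfolding prime_spectrum_def topology_generated_by_topspace spectrum_basic_open_def by blast
qed

lemma spectrum_basic_open_meet:
  assumes "lattice L" and a: "a \<in> carrier L" and b: "b \<in> carrier L"
  shows "spectrum_basic_open L (a \<sqinter>\<^bsub>L\<^esub> b) = spectrum_basic_open L a \<inter> spectrum_basic_open L b"
proof -
  interpret lattice L by fact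
  have "a \<sqinter>\<^bsub>L\<^esub> b \<in> carrier L" "a \<sqinter>\<^bsub>L\<^esub> b \<sqsubseteq>\<^bsub>L\<^esub> a" "a \<sqinter>\<^bsub>L\<^esub> b \<sqsubseteq>\<^bsub>L\<^esub> b"
    using a b by (auto intro: meet_closed meet_left meet_right)
  then show ?thesis
    using a b unfolding spectrum_basic_open_def lattice_prime_ideal_def lattice_ideal_def
    by blast
qed

lemma base_of_prime_spectrum:
  assumes "lattice L"
  shows "base_of (prime_spectrum L) (spectrum_basic_open L ` carrier L)"
proof -
  let ?B = "spectrum_basic_open L ` carrier L"
  interpret lattice L by fact
  have "\<exists>B'\<subseteq>?B. \<Union>B' = U" if "generate_topology_on ?B U" for U
    using that
  proof (induction rule: generate_topology_on.induct)
    case Empty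
    show ?case by (rule exI[of _ "{}"]) simp
  next
    case (Int U V)
    then obtain P Q where PQ: "P \<subseteq> ?B" "\<Union>P = U" "Q \<subseteq> ?B" "\<Union>Q = V" by (elim exE conjE)
    have "X \<inter> Y \<in> ?B" if XY: "X \<in> P" "Y \<in> Q" for X Y
    proof -
      obtain a b where "a \<in> carrier L" "X = spectrum_basic_open L a"
        "b \<in> carrier L" "Y = spectrum_basic_open L b"
        using XY PQ(1,3) by (meson imageE subsetD)
      then show ?thesis
        using spectrum_basic_open_meet[OF assms, of a b] meet_closed[of a b]
        by (metis imageI)
    qed
    then have "{X \<inter> Y |X Y. X \<in> P \<and> Y \<in> Q} \<subseteq> ?B" by blast
    moreover have "\<Union>{X \<inter> Y |X Y. X \<in> P \<and> Y \<in> Q} = \<Union>P \<inter> \<Union>Q" by blast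
    ultimately show ?case unfolding PQ by (intro exI conjI)
  next
    case (UN K)
    then have "\<forall>k\<in>K. \<exists>B'. B' \<subseteq> ?B \<and> \<Union>B' = k" by simp
    then obtain f where f: "\<forall>k\<in>K. f k \<subseteq> ?B \<and> \<Union>(f k) = k"
      unfolding bchoice_iff by blast
    have "\<Union>(f ` K) \<subseteq> ?B" using f by (intro UN_least) simp
    moreover have "\<Union>(\<Union>(f ` K)) = (\<Union>k\<in>K. \<Union>(f k))" by blast
    moreover have "\<dots> = \<Union>K" using f by simp
    ultimately show ?case by (intro exI[of _ "\<Union>(f ` K)"]) simp
  next
    case (Basis s)
    then show ?case by (intro exI[of _ "{s}"]) simp
  qed
  then show ?thesis
    unfolding base_of_def prime_spectrum_def openin_topology_generated_by_iff
    by (intro conjI ballI allI impI generate_topology_on.Basis)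
qed

text \<open>
  HOL cannot quantify existentially over types, so the type containing the carrier of the lattice
  is a parameter. Whenever \<open>X\<close> is homeomorphic to the prime spectrum of a distributive lattice
  \<open>L\<close>, mapping \<open>a\<close> to the corresponding open subset of \<open>X\<close> identifies \<open>L\<close> with a lattice of sets;
  hence for \<open>X :: 'a topology\<close> the type \<open>'a set\<close> is large enough for all such lattices.
\<close>

definition balbes_dwinger_space :: "'b itself \<Rightarrow> 'a topology \<Rightarrow> bool" where
  "balbes_dwinger_space (_ :: 'b itself) X \<longleftrightarrow>
     (\<exists>L :: 'b gorder. distributive_lattice L \<and> X homeomorphic_space prime_spectrum L)"

definition spectrum_of_lattice_with_max :: "'b itself \<Rightarrow> 'a topology \<Rightarrow> bool" where
  "spectrum_of_lattice_with_max (_ :: 'b itself) X \<longleftrightarrow>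
     (\<exists>L :: 'b gorder. distributive_lattice L \<and> (\<exists>m. greatest L m (carrier L)) \<and>
        X homeomorphic_space prime_spectrum L)"

end

theory Submission
  imports Defs
begin

text \<open>
  Every space homeomorphic to a prime spectrum carries a base, closed under binary unions and
  intersections, whose prime ideals are exactly the families of members missing a given point; such
  a base recovers the spectrum. By the prime ideal theorem its members are compact, and if the whole
  space is compact then it is the maximum of the base. Conversely, for a down-spectral space take
  all compact open sets, leaving out the empty set exactly when the space is irreducible without a
  generic point: there the ideal \<open>{{}}\<close> would be a prime ideal not coming from any point.
\<close>

section \<open>Lattices of sets\<close>

definition lattice_of_sets :: "'a set set \<Rightarrow> bool" where
  "lattice_of_sets L \<longleftrightarrow> (\<forall>U\<in>L. \<forall>V\<in>L. U \<union> V \<in> L \<and> U \<inter> V \<in> L)"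

definition inclusion_order :: "'a set set \<Rightarrow> 'a set gorder" where
  "inclusion_order L = \<lparr>carrier = L, eq = (=), le = (\<subseteq>)\<rparr>"

lemma carrier_inclusion_order [simp]: "carrier (inclusion_order L) = L"
  and le_inclusion_order [simp]: "le (inclusion_order L) = (\<subseteq>)"
  and eq_inclusion_order [simp]: "eq (inclusion_order L) = (=)"
  by (simp_all add: inclusion_order_def)

lemma partial_order_inclusion_order: "partial_order (inclusion_order L)"
  by unfold_locales auto

lemma least_Upper_inclusion_order:
  assumes "lattice_of_sets L" "U \<in> L" "V \<in> L"
  shows "least (inclusion_order L) (U \<union> V) (Upper (inclusion_order L) {U, V})"
  using assms by (auto simp: least_def Upper_def lattice_of_sets_def)

lemma greatest_Lower_inclusion_order:
  assumes "lattice_of_sets L" "U \<in> L" "V \<in> L"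
  shows "greatest (inclusion_order L) (U \<inter> V) (Lower (inclusion_order L) {U, V})"
  using assms by (auto simp: greatest_def Lower_def lattice_of_sets_def)

lemma lattice_inclusion_order:
  assumes "lattice_of_sets L"
  shows "lattice (inclusion_order L)"
proof -
  interpret partial_order "inclusion_order L" by (rule partial_order_inclusion_order)
  show ?thesis
    by unfold_locales
      (auto intro: least_Upper_inclusion_order[OF assms] greatest_Lower_inclusion_order[OF assms])
qed

lemma join_inclusion_order:
  assumes "lattice_of_sets L" "U \<in> L" "V \<in> L"
  shows "U \<squnion>\<^bsub>inclusion_order L\<^esub> V = U \<union> V"
proof -
  interpret partial_order "inclusion_order L" by (rule partial_order_inclusion_order)
  show ?thesis
    unfolding join_def sup_def
    using least_Upper_inclusion_order[OF assms] by (meson least_unique some_equality)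
qed

lemma meet_inclusion_order:
  assumes "lattice_of_sets L" "U \<in> L" "V \<in> L"
  shows "U \<sqinter>\<^bsub>inclusion_order L\<^esub> V = U \<inter> V"
proof -
  interpret partial_order "inclusion_order L" by (rule partial_order_inclusion_order)
  show ?thesis
    unfolding meet_def inf_def
    using greatest_Lower_inclusion_order[OF assms] by (meson greatest_unique some_equality)
qed

lemma distributive_lattice_inclusion_order:
  assumes "lattice_of_sets L" "L \<noteq> {}"
  shows "distributive_lattice (inclusion_order L)"
proof -
  have "U \<union> V \<in> L" "U \<inter> V \<in> L" if "U \<in> L" "V \<in> L" for U V
    using assms(1) that by (auto simp: lattice_of_sets_def)
  then show ?thesis
    using assms lattice_inclusion_order[OF assms(1)]
    by (simp add: distributive_lattice_def join_inclusion_order meet_inclusion_order Int_Un_distrib)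
qed

section \<open>Ideals of a lattice of sets and the prime ideal theorem\<close>

lemma lattice_ideal_inclusion_order:
  assumes "lattice_of_sets L"
  shows "lattice_ideal (inclusion_order L) I \<longleftrightarrow>
    I \<subseteq> L \<and> I \<noteq> {} \<and> (\<forall>U\<in>I. \<forall>V\<in>L. V \<subseteq> U \<longrightarrow> V \<in> I) \<and> (\<forall>U\<in>I. \<forall>V\<in>I. U \<union> V \<in> I)"
proof -
  have "(\<forall>U\<in>I. \<forall>V\<in>I. U \<squnion>\<^bsub>inclusion_order L\<^esub> V \<in> I) \<longleftrightarrow> (\<forall>U\<in>I. \<forall>V\<in>I. U \<union> V \<in> I)" if "I \<subseteq> L"
    using that assms by (intro ball_cong) (auto simp: join_inclusion_order subset_iff)
  then show ?thesis
    unfolding lattice_ideal_def by auto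
qed

lemma lattice_prime_ideal_inclusion_order:
  assumes "lattice_of_sets L"
  shows "lattice_prime_ideal (inclusion_order L) I \<longleftrightarrow>
    lattice_ideal (inclusion_order L) I \<and> I \<noteq> L \<and>
    (\<forall>U\<in>L. \<forall>V\<in>L. U \<inter> V \<in> I \<longrightarrow> U \<in> I \<or> V \<in> I)"
  using assms unfolding lattice_prime_ideal_def by (simp add: meet_inclusion_order)

lemma lattice_of_sets_Union_finite:
  assumes "lattice_of_sets L" "finite \<F>" "\<F> \<noteq> {}" "\<F> \<subseteq> L"
  shows "\<Union>\<F> \<in> L"
  using assms(2-4)
proof (induction rule: finite_ne_induct)
  case (insert U \<F>)
  then show ?case using assms(1) by (simp add: lattice_of_sets_def)
qed simp

text \<open>This is the form in which compactness meets ideals. If the finite family is empty,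
  \<open>U\<close> is the empty set, which lies in \<open>I\<close> because it lies in
  \<open>L\<close> and \<open>I\<close> is a non-empty lower set.\<close>

lemma lattice_ideal_inclusion_order_Union_finite:
  assumes L: "lattice_of_sets L" and I: "lattice_ideal (inclusion_order L) I"
    and U: "U \<in> L" and \<F>: "finite \<F>" "\<F> \<subseteq> I" "U \<subseteq> \<Union>\<F>"
  shows "U \<in> I"
proof (cases "\<F> = {}")
  case True
  then show ?thesis
    using I U \<F> unfolding lattice_ideal_inclusion_order[OF L] by auto
next
  case False
  have "\<Union>\<F> \<in> I"
    using \<F>(1) False \<F>(2)
  proof (induction rule: finite_ne_induct)
    case (insert V \<G>)
    then show ?case
      using I unfolding lattice_ideal_inclusion_order[OF L] by simp
  qed simp
  then show ?thesis
    using I U \<F>(3) unfolding lattice_ideal_inclusion_order[OF L] by blast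
qed

text \<open>Zorn's lemma gives an ideal \<open>M\<close> maximal among those that contain
  \<open>A\<close> and avoid \<open>U\<close>. Distributivity makes \<open>M\<close> prime, since
  enlarging it by any further member of \<open>L\<close> forces \<open>U\<close> into the
  ideal.\<close>

lemma prime_ideal_separation:
  assumes L: "lattice_of_sets L" and A: "lattice_ideal (inclusion_order L) A"
    and U: "U \<in> L" "U \<notin> A"
  obtains I where "lattice_prime_ideal (inclusion_order L) I" "A \<subseteq> I" "U \<notin> I"
proof -
  note ideal = lattice_ideal_inclusion_order[OF L]
  let ?S = "{I. lattice_ideal (inclusion_order L) I \<and> A \<subseteq> I \<and> U \<notin> I}"
  have "\<exists>M\<in>?S. \<forall>X\<in>?S. M \<subseteq> X \<longrightarrow> X = M"
  proof (rule subset_Zorn_nonempty)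
    show "?S \<noteq> {}" using A U by blast
    fix C assume C: "C \<noteq> {}" "subset.chain ?S C"
    then have "C \<subseteq> ?S" by (simp add: subset.chain_def)
    then have CS: "Z \<subseteq> L" "A \<subseteq> Z" "U \<notin> Z" "\<And>X Y. X \<in> Z \<Longrightarrow> Y \<in> L \<Longrightarrow> Y \<subseteq> X \<Longrightarrow> Y \<in> Z"
      "\<And>X Y. X \<in> Z \<Longrightarrow> Y \<in> Z \<Longrightarrow> X \<union> Y \<in> Z" if "Z \<in> C" for Z
      using that unfolding ideal by blast+
    \<comment> \<open>In a chain two elements of the union already lie in a common ideal, so the
      union is closed under joins.\<close>
    have "\<exists>Z\<in>C. X \<in> Z \<and> Y \<in> Z" if "X \<in> \<Union>C" "Y \<in> \<Union>C" for X Y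
      using that C(2) unfolding subset_chain_def by blast
    then have "\<forall>X\<in>\<Union>C. \<forall>Y\<in>\<Union>C. X \<union> Y \<in> \<Union>C" by (meson CS(5) UnionI)
    moreover have "\<Union>C \<subseteq> L" using CS(1) by (rule Union_least)
    moreover have "\<forall>X\<in>\<Union>C. \<forall>Y\<in>L. Y \<subseteq> X \<longrightarrow> Y \<in> \<Union>C" by (meson CS(4) UnionE UnionI)
    moreover have "A \<subseteq> \<Union>C" using CS(2) C(1) by blast
    moreover have "U \<notin> \<Union>C" using CS(3) by blast
    moreover have "A \<noteq> {}" using A unfolding ideal by simp
    moreover from calculation have "\<Union>C \<noteq> {}" by (metis subset_empty)
    ultimately show "\<Union>C \<in> ?S"
      unfolding ideal by simp
  qed
  then obtain M where M: "lattice_ideal (inclusion_order L) M" "A \<subseteq> M" "U \<notin> M"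
    and max: "\<forall>X\<in>?S. M \<subseteq> X \<longrightarrow> X = M"
    by auto
  have M': "M \<subseteq> L" "M \<noteq> {}" "\<And>X Y. X \<in> M \<Longrightarrow> Y \<in> L \<Longrightarrow> Y \<subseteq> X \<Longrightarrow> Y \<in> M"
    "\<And>X Y. X \<in> M \<Longrightarrow> Y \<in> M \<Longrightarrow> X \<union> Y \<in> M"
    using M(1) unfolding ideal by auto
  have L': "\<And>X Y. X \<in> L \<Longrightarrow> Y \<in> L \<Longrightarrow> X \<union> Y \<in> L \<and> X \<inter> Y \<in> L"
    using L by (auto simp: lattice_of_sets_def)
  have extend: "\<exists>N\<in>M. U \<subseteq> N \<union> V" if V: "V \<in> L" "V \<notin> M" for V
  proof (rule ccontr)
    assume no: "\<not> ?thesis"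
    \<comment> \<open>\<open>N\<close> is the ideal generated by \<open>M\<close> and
      \<open>V\<close>; if it avoided \<open>U\<close>, maximality would give \<open>N = M\<close>,
      although \<open>V\<close> lies only in \<open>N\<close>.\<close>
    define N where "N = {X\<in>L. \<exists>W\<in>M. X \<subseteq> W \<union> V}"
    have MN: "M \<subseteq> N" using M' unfolding N_def by blast
    have VN: "V \<in> N" using V M' unfolding N_def by blast
    have "X \<union> Y \<in> N" if XY: "X \<in> N" "Y \<in> N" for X Y
    proof -
      obtain W W' where "W \<in> M" "X \<subseteq> W \<union> V" "W' \<in> M" "Y \<subseteq> W' \<union> V"
        using XY unfolding N_def by blast
      then have "W \<union> W' \<in> M" "X \<union> Y \<subseteq> (W \<union> W') \<union> V" using M'(4) by blast+
      moreover have "X \<union> Y \<in> L" using L' XY unfolding N_def by blast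
      ultimately show ?thesis unfolding N_def by blast
    qed
    moreover have "Y \<in> N" if "X \<in> N" "Y \<in> L" "Y \<subseteq> X" for X Y
      using that unfolding N_def by blast
    moreover have "N \<subseteq> L" unfolding N_def by blast
    moreover have "N \<noteq> {}" using VN by blast
    ultimately have "lattice_ideal (inclusion_order L) N"
      unfolding ideal by simp
    moreover have "U \<notin> N" using no unfolding N_def by blast
    moreover have "A \<subseteq> N" using M(2) MN by (rule order_trans)
    ultimately have "N = M" using bspec[OF max, of N] MN by simp
    then show False using VN V(2) by metis
  qed
  have "V \<in> M \<or> W \<in> M" if VW: "V \<in> L" "W \<in> L" "V \<inter> W \<in> M" for V W
  proof (rule ccontr)
    assume "\<not> ?thesis"
    then obtain N N' where "N \<in> M" "U \<subseteq> N \<union> V" "N' \<in> M" "U \<subseteq> N' \<union> W"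
      using extend VW by meson
    \<comment> \<open>Distributivity enters here: the intersection of \<open>N \<union> V\<close>
      and \<open>N' \<union> W\<close> is contained in
      \<open>N \<union> N' \<union> (V \<inter> W)\<close>.\<close>
    then have "N \<union> N' \<union> (V \<inter> W) \<in> M" "U \<subseteq> N \<union> N' \<union> (V \<inter> W)" using M'(4) VW(3) by blast+
    then show False using M'(3) M(3) U by blast
  qed
  then have "lattice_prime_ideal (inclusion_order L) M"
    unfolding lattice_prime_ideal_inclusion_order[OF L] using M(1,3) U(1) by blast
  then show ?thesis using M(2,3) by (rule that)
qed

section \<open>Bases whose prime ideals are the points\<close>

definition point_ideal :: "'a set set \<Rightarrow> 'a \<Rightarrow> 'a set set" where
  "point_ideal L x = {U \<in> L. x \<notin> U}"

text \<open>An intrinsic form of being a prime spectrum, with the lattice realised by open sets of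
  \<open>Z\<close> itself. The last equation demands two things: every prime ideal comes from a
  point, and every point misses some member and lies in another. The empty set may or may not be a
  member.\<close>

definition spectral_base :: "'a topology \<Rightarrow> 'a set set \<Rightarrow> bool" where
  "spectral_base Z L \<longleftrightarrow>
     L \<noteq> {} \<and> lattice_of_sets L \<and> base_of Z L \<and> t0_space Z \<and>
     {I. lattice_prime_ideal (inclusion_order L) I} = point_ideal L ` topspace Z"

section \<open>From a spectral base to the prime spectrum\<close>

lemma base_of_nbhd:
  assumes "base_of Z L" "openin Z W" "x \<in> W"
  obtains V where "V \<in> L" "x \<in> V" "V \<subseteq> W"
proof -
  obtain B' where "B' \<subseteq> L" "\<Union>B' = W" using assms unfolding base_of_def by blast
  then show ?thesis using that assms(3) by blast
qed

lemma base_of_Union: "base_of Z L \<Longrightarrow> openin Z W \<Longrightarrow> \<exists>B'\<subseteq>L. \<Union>B' = W"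
  unfolding base_of_def by blast

lemma base_of_openin: "base_of Z L \<Longrightarrow> U \<in> L \<Longrightarrow> openin Z U"
  unfolding base_of_def by blast

lemma inj_on_point_ideal:
  assumes "base_of Z L" "t0_space Z"
  shows "inj_on (point_ideal L) (topspace Z)"
proof
  fix x y assume xy: "x \<in> topspace Z" "y \<in> topspace Z" "point_ideal L x = point_ideal L y"
  then have same: "\<And>V. V \<in> L \<Longrightarrow> x \<in> V \<longleftrightarrow> y \<in> V"
    unfolding point_ideal_def by blast
  show "x = y"
  proof (rule ccontr)
    assume "x \<noteq> y"
    then obtain W where "openin Z W" "x \<notin> W \<longleftrightarrow> y \<in> W"
      using assms(2) xy unfolding t0_space_def by blast
    then show False using same base_of_nbhd[OF assms(1)] by (metis subsetD)
  qed
qed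

text \<open>The homeomorphism is \<open>point_ideal L\<close>: it is injective by the T0 axiom, onto
  by the condition on prime ideals, and it carries each base member \<open>U\<close> to the basic
  open set of \<open>U\<close>.\<close>

lemma spectral_base_homeomorphic:
  assumes "spectral_base Z L"
  shows "Z homeomorphic_space prime_spectrum (inclusion_order L)"
proof -
  let ?S = "prime_spectrum (inclusion_order L)" and ?h = "point_ideal L"
  have L: "lattice_of_sets L" and base: "base_of Z L" and t0: "t0_space Z"
    and prime: "{I. lattice_prime_ideal (inclusion_order L) I} = ?h ` topspace Z"
    using assms unfolding spectral_base_def by auto
  have basic: "spectrum_basic_open (inclusion_order L) U = ?h ` U" if "U \<in> L" for U
  proof -
    have "U \<subseteq> topspace Z" using base_of_openin[OF base that] openin_subset by blast
    then show ?thesis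
      using prime that unfolding spectrum_basic_open_def point_ideal_def by blast
  qed
  have "homeomorphic_map Z ?S ?h"
  proof (rule bijective_open_imp_homeomorphic_map)
    show "inj_on ?h (topspace Z)" by (rule inj_on_point_ideal[OF base t0])
    show "?h ` topspace Z = topspace ?S"
      unfolding topspace_prime_spectrum prime ..
    show "continuous_map Z ?S ?h"
      unfolding prime_spectrum_def
    proof (rule continuous_on_generated_topo)
      fix D assume "D \<in> spectrum_basic_open (inclusion_order L) ` carrier (inclusion_order L)"
      then obtain U where U: "U \<in> L" "D = ?h ` U" using basic by auto
      have "?h -` D \<inter> topspace Z = U"
        using U base_of_openin[OF base U(1)] openin_subset unfolding point_ideal_def by blast
      then show "openin Z (?h -` D \<inter> topspace Z)" using base_of_openin[OF base U(1)] by simp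
    next
      show "?h ` topspace Z \<subseteq> \<Union>(spectrum_basic_open (inclusion_order L) ` carrier (inclusion_order L))"
        using topspace_prime_spectrum[of "inclusion_order L"] prime
        unfolding prime_spectrum_def topology_generated_by_topspace by simp
    qed
    show "open_map Z ?S ?h"
      unfolding open_map_def
    proof (intro allI impI)
      fix W assume "openin Z W"
      then obtain B' where B': "B' \<subseteq> L" "\<Union>B' = W" using base unfolding base_of_def by blast
      have "openin ?S (?h ` U)" if "U \<in> B'" for U
        using that B' basic[of U] unfolding prime_spectrum_def
        by (metis carrier_inclusion_order imageI subsetD topology_generated_by_Basis)
      then have "openin ?S (\<Union>U\<in>B'. ?h ` U)" by blast
      then show "openin ?S (?h ` W)" unfolding B'(2)[symmetric] by (simp add: image_Union)
    qed
  qed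
  then show ?thesis by (rule homeomorphic_map_imp_homeomorphic_space)
qed

text \<open>The map \<open>a \<mapsto> {x. a \<notin> f x}\<close> need not be shown injective: two elements with the same image lie
  in the same prime ideals.\<close>

lemma spectral_base_of_homeomorphic_map:
  fixes M :: "('b, 'm) gorder_scheme"
  assumes M: "lattice M" "carrier M \<noteq> {}" and f: "homeomorphic_map Z (prime_spectrum M) f"
  defines "u \<equiv> \<lambda>a. {x \<in> topspace Z. a \<notin> f x}"
  shows "spectral_base Z (u ` carrier M)"
proof -
  interpret lattice M by fact
  let ?S = "prime_spectrum M" and ?L = "u ` carrier M"
  have bij: "f ` topspace Z = {I. lattice_prime_ideal M I}" "inj_on f (topspace Z)"
    using f unfolding homeomorphic_eq_everything_map topspace_prime_spectrum by auto
  have fx: "lattice_prime_ideal M (f x)" if "x \<in> topspace Z" for x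
    using that bij by blast
  have u_image: "f ` u a = spectrum_basic_open M a" for a
    using bij(1) unfolding u_def spectrum_basic_open_def by blast
  have u_sub: "u a \<subseteq> topspace Z" for a
    unfolding u_def by blast
  have u_join: "u (a \<squnion>\<^bsub>M\<^esub> b) = u a \<union> u b" if "a \<in> carrier M" "b \<in> carrier M" for a b
  proof -
    \<comment> \<open>Joins are governed by the ideal axioms alone; primality is what handles
      meets.\<close>
    have "a \<squnion>\<^bsub>M\<^esub> b \<in> I \<longleftrightarrow> a \<in> I \<and> b \<in> I" if "lattice_ideal M I" for I
      using \<open>a \<in> _\<close> \<open>b \<in> _\<close> that join_left[of a b] join_right[of a b] join_closed[of a b]
      unfolding lattice_ideal_def by blast
    then show ?thesis using fx unfolding u_def lattice_prime_ideal_def by blast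
  qed
  have u_meet: "u (a \<sqinter>\<^bsub>M\<^esub> b) = u a \<inter> u b" if "a \<in> carrier M" "b \<in> carrier M" for a b
  proof -
    have "f ` u (a \<sqinter>\<^bsub>M\<^esub> b) = f ` (u a \<inter> u b)"
      unfolding inj_on_image_Int[OF bij(2) u_sub u_sub] u_image
      using M(1) that by (rule spectrum_basic_open_meet)
    moreover have "u a \<inter> u b \<subseteq> topspace Z" using u_sub by blast
    ultimately show ?thesis
      using inj_on_image_eq_iff[OF bij(2) u_sub] by metis
  qed
  have L: "lattice_of_sets ?L"
    unfolding lattice_of_sets_def
    using u_join[symmetric] u_meet[symmetric] by auto
  have open_iff: "openin Z W \<longleftrightarrow> openin ?S (f ` W)" if "W \<subseteq> topspace Z" for W
    using homeomorphic_map_openness_eq[OF f] that homeomorphic_map_openness[OF f] by blast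
  have base: "base_of Z ?L"
    unfolding base_of_def
  proof (intro conjI ballI allI impI)
    show "openin Z U" if "U \<in> ?L" for U
      using that base_of_openin[OF base_of_prime_spectrum[OF M(1)]] open_iff u_sub u_image by auto
    fix W assume W: "openin Z W"
    then have "openin ?S (f ` W)" using open_iff openin_subset by blast
    then obtain B' where B': "B' \<subseteq> spectrum_basic_open M ` carrier M" "\<Union>B' = f ` W"
      using base_of_Union[OF base_of_prime_spectrum[OF M(1)]] by metis
    then obtain A where A: "A \<subseteq> carrier M" "B' = spectrum_basic_open M ` A"
      unfolding subset_image_iff by metis
    have "f ` (\<Union>(u ` A)) = f ` W"
      using A B'(2) u_image by (simp add: image_UN)
    moreover have "\<Union>(u ` A) \<subseteq> topspace Z" using u_sub by blast
    ultimately have "\<Union>(u ` A) = W"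
      using inj_on_image_eq_iff[OF bij(2) _ openin_subset[OF W]] by metis
    then show "\<exists>B'\<subseteq>?L. \<Union>B' = W" using image_mono[OF A(1)] by metis
  qed
  have t0: "t0_space Z"
    unfolding t0_space_def
  proof (intro ballI impI)
    fix x y assume xy: "x \<in> topspace Z" "y \<in> topspace Z" "x \<noteq> y"
    then have "f x \<noteq> f y" using bij(2) by (auto dest: inj_onD)
    moreover have "f x \<subseteq> carrier M" "f y \<subseteq> carrier M"
      using fx xy unfolding lattice_prime_ideal_def lattice_ideal_def by blast+
    ultimately obtain a where "a \<in> carrier M" "a \<in> f x \<longleftrightarrow> a \<notin> f y" by blast
    then have "openin Z (u a)" "x \<notin> u a \<longleftrightarrow> y \<in> u a"
      using base_of_openin[OF base] xy unfolding u_def by auto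
    then show "\<exists>U. openin Z U \<and> (x \<notin> U \<longleftrightarrow> y \<in> U)" by blast
  qed
  have u_mono: "u a \<subseteq> u b" if "a \<in> carrier M" "b \<in> carrier M" "a \<sqsubseteq>\<^bsub>M\<^esub> b" for a b
    using that fx unfolding u_def lattice_prime_ideal_def lattice_ideal_def by blast
  note ideal = lattice_ideal_inclusion_order[OF L]
  note prime = lattice_prime_ideal_inclusion_order[OF L]
  have "lattice_prime_ideal (inclusion_order ?L) I \<longleftrightarrow> I \<in> point_ideal ?L ` topspace Z" for I
  proof
    assume I: "lattice_prime_ideal (inclusion_order ?L) I"
    then have I': "I \<subseteq> ?L" "I \<noteq> {}" "I \<noteq> ?L"
      "\<And>U V. U \<in> I \<Longrightarrow> V \<in> ?L \<Longrightarrow> V \<subseteq> U \<Longrightarrow> V \<in> I" "\<And>U V. U \<in> I \<Longrightarrow> V \<in> I \<Longrightarrow> U \<union> V \<in> I"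
      "\<And>U V. U \<in> ?L \<Longrightarrow> V \<in> ?L \<Longrightarrow> U \<inter> V \<in> I \<Longrightarrow> U \<in> I \<or> V \<in> I"
      unfolding prime ideal by blast+
    \<comment> \<open>The preimage of \<open>I\<close> under \<open>u\<close> is a prime ideal of
      \<open>M\<close>, hence the value of \<open>f\<close> at some point, and that point represents
      \<open>I\<close>.\<close>
    let ?J = "{a \<in> carrier M. u a \<in> I}"
    have "?J \<noteq> {}" "?J \<noteq> carrier M" using I'(1-3) by blast+
    moreover have "b \<in> ?J" if "a \<in> ?J" "b \<in> carrier M" "b \<sqsubseteq>\<^bsub>M\<^esub> a" for a b
      using that u_mono[of b a] I'(4) by blast
    moreover have "a \<squnion>\<^bsub>M\<^esub> b \<in> ?J" if "a \<in> ?J" "b \<in> ?J" for a b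
      using that u_join I'(5) by simp
    moreover have "a \<in> ?J \<or> b \<in> ?J" if "a \<in> carrier M" "b \<in> carrier M" "a \<sqinter>\<^bsub>M\<^esub> b \<in> ?J" for a b
      using that u_meet I'(6) by simp
    ultimately have "lattice_prime_ideal M ?J"
      unfolding lattice_prime_ideal_def lattice_ideal_def by blast
    then have "?J \<in> f ` topspace Z" unfolding bij(1) by simp
    then obtain x where x: "x \<in> topspace Z" "f x = ?J" by auto
    have "u a \<in> I \<longleftrightarrow> x \<notin> u a" if "a \<in> carrier M" for a
    proof -
      have "x \<notin> u a \<longleftrightarrow> a \<in> f x" using x(1) by (simp add: u_def)
      then show ?thesis using x(2) that by simp
    qed
    then have "I = point_ideal ?L x"
      using I'(1) unfolding point_ideal_def by blast
    then show "I \<in> point_ideal ?L ` topspace Z" using x by blast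
  next
    assume "I \<in> point_ideal ?L ` topspace Z"
    then obtain x where x: "x \<in> topspace Z" "I = point_ideal ?L x" by blast
    \<comment> \<open>Only non-emptiness and properness of a point ideal need an argument; both are
      inherited from the prime ideal \<open>f x\<close>. The other axioms hold for the members
      missing any given point.\<close>
    have "u a \<in> I \<longleftrightarrow> a \<in> f x" if "a \<in> carrier M" for a
      using that x unfolding point_ideal_def u_def by blast
    moreover have "f x \<subseteq> carrier M" "f x \<noteq> {}" "f x \<noteq> carrier M"
      using fx[OF x(1)] unfolding lattice_prime_ideal_def lattice_ideal_def by blast+
    ultimately have "I \<noteq> {}" "I \<noteq> ?L" by blast+
    then show "lattice_prime_ideal (inclusion_order ?L) I"
      using L unfolding prime ideal x(2) point_ideal_def lattice_of_sets_def by blast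
  qed
  then show ?thesis
    using L base t0 M(2) unfolding spectral_base_def by blast
qed

text \<open>Given an open cover of \<open>U\<close> without finite subcover, the finitely covered
  members of \<open>L\<close> form an ideal avoiding \<open>U\<close>. A prime ideal separating them
  belongs to a point of \<open>U\<close> that lies in no finitely covered member, but each point of
  \<open>U\<close> has a base neighbourhood inside a single set of the cover.\<close>

lemma spectral_base_compactin:
  assumes S: "spectral_base Z L" and U: "U \<in> L"
  shows "compactin Z U"
proof -
  have L: "lattice_of_sets L" and base: "base_of Z L"
    and prime: "{I. lattice_prime_ideal (inclusion_order L) I} = point_ideal L ` topspace Z"
    using S unfolding spectral_base_def by auto
  have "\<exists>\<F>. finite \<F> \<and> \<F> \<subseteq> \<U> \<and> U \<subseteq> \<Union>\<F>"
    if \<U>: "\<forall>W\<in>\<U>. openin Z W" "U \<subseteq> \<Union>\<U>" for \<U>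
  proof (rule ccontr)
    assume no: "\<not> ?thesis"
    define A where "A = {V\<in>L. \<exists>\<F>. finite \<F> \<and> \<F> \<subseteq> \<U> \<and> V \<subseteq> \<Union>\<F>}"
    have member: "\<exists>V\<in>A. x \<in> V" if x: "x \<in> U" for x
    proof -
      obtain W where W: "W \<in> \<U>" "x \<in> W" using x \<U>(2) by blast
      then obtain V where "V \<in> L" "x \<in> V" "V \<subseteq> W" using base_of_nbhd[OF base, of W x] \<U>(1) by blast
      then show ?thesis using W unfolding A_def by (intro bexI[of _ V]) (auto intro!: exI[of _ "{W}"])
    qed
    have "U \<notin> A" using no unfolding A_def by blast
    \<comment> \<open>The empty family covers the empty set. A point of \<open>U\<close> is what
      makes \<open>A\<close> non-empty, as \<open>{}\<close> need not belong to
      \<open>L\<close>.\<close>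
    have "U \<noteq> {}" using no by blast
    then have "A \<noteq> {}" using member by blast
    moreover have "V \<union> W \<in> A" if VW: "V \<in> A" "W \<in> A" for V W
    proof -
      obtain \<F> \<G> where "finite \<F>" "\<F> \<subseteq> \<U>" "V \<subseteq> \<Union>\<F>" "finite \<G>" "\<G> \<subseteq> \<U>" "W \<subseteq> \<Union>\<G>"
        using VW unfolding A_def by blast
      then have "finite (\<F> \<union> \<G>) \<and> \<F> \<union> \<G> \<subseteq> \<U> \<and> V \<union> W \<subseteq> \<Union>(\<F> \<union> \<G>)" by blast
      moreover have "V \<union> W \<in> L" using L VW unfolding A_def lattice_of_sets_def by blast
      ultimately show ?thesis unfolding A_def by blast
    qed
    moreover have "W \<in> A" if "V \<in> A" "W \<in> L" "W \<subseteq> V" for V W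
      using that unfolding A_def by blast
    moreover have "A \<subseteq> L" unfolding A_def by blast
    ultimately have "lattice_ideal (inclusion_order L) A"
      unfolding lattice_ideal_inclusion_order[OF L] by simp
    then obtain I where I: "lattice_prime_ideal (inclusion_order L) I" "A \<subseteq> I" "U \<notin> I"
      using prime_ideal_separation[OF L _ U \<open>U \<notin> A\<close>] by blast
    then obtain x where "I = point_ideal L x" using prime by blast
    then have "x \<in> U" "\<forall>V\<in>A. x \<notin> V" using I U unfolding point_ideal_def by blast+
    then show False using member by blast
  qed
  then show ?thesis
    using openin_subset[OF base_of_openin[OF base U]] unfolding compactin_def by metis
qed

text \<open>Compactness writes the space as a finite union of base members, which stays in
  \<open>L\<close> if the family is non-empty. If it is empty, so is the space, and any member of
  \<open>L\<close> equals it.\<close>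

lemma spectral_base_topspace_mem:
  assumes "spectral_base Z L" "compact_space Z"
  shows "topspace Z \<in> L"
proof -
  have ne: "L \<noteq> {}" and L: "lattice_of_sets L" and base: "base_of Z L"
    using assms(1) unfolding spectral_base_def by auto
  obtain B' where B': "B' \<subseteq> L" "\<Union>B' = topspace Z"
    using base unfolding base_of_def by (meson openin_topspace)
  have "\<exists>\<F>. finite \<F> \<and> \<F> \<subseteq> B' \<and> topspace Z \<subseteq> \<Union>\<F>"
    using B' base_of_openin[OF base] assms(2) unfolding compact_space_def by (intro compactinD) auto
  then obtain \<F> where \<F>: "finite \<F>" "\<F> \<subseteq> B'" "topspace Z \<subseteq> \<Union>\<F>"
    by metis
  then have eq: "\<Union>\<F> = topspace Z" using B'(2) by blast
  show ?thesis
  proof (cases "\<F> = {}")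
    case True
    then have "topspace Z = {}" using eq by simp
    moreover obtain U where "U \<in> L" using ne by blast
    ultimately show ?thesis using base_of_openin[OF base] openin_subset by (metis subset_empty)
  next
    case False
    then show ?thesis using lattice_of_sets_Union_finite[OF L \<F>(1)] \<F>(2) B'(1) eq by auto
  qed
qed

lemma spectral_base_compact_space_iff:
  assumes "spectral_base Z L"
  shows "compact_space Z \<longleftrightarrow> topspace Z \<in> L"
  using spectral_base_topspace_mem[OF assms] spectral_base_compactin[OF assms]
  unfolding compact_space_def by blast

section \<open>Down-spectral spaces\<close>

lemma irreducible_closedin_Int_open:
  assumes F: "irreducible_closedin Z F" and UV: "openin Z U" "openin Z V"
    and ne: "F \<inter> U \<noteq> {}" "F \<inter> V \<noteq> {}"
  shows "F \<inter> (U \<inter> V) \<noteq> {}"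
proof
  assume empty: "F \<inter> (U \<inter> V) = {}"
  have "closedin Z F" using F unfolding irreducible_closedin_def by blast
  then have "closedin Z (F - U)" "closedin Z (F - V)"
    using UV by (auto intro: closedin_diff)
  moreover have "F = (F - U) \<union> (F - V)" using empty by blast
  ultimately have "F = F - U \<or> F = F - V"
    using F unfolding irreducible_closedin_def by blast
  then show False using ne by blast
qed

text \<open>If \<open>F\<close> split into two proper closed parts, a point outside each part would
  have a base neighbourhood missing that part, and the two neighbourhoods could not meet inside
  \<open>F\<close>.\<close>

lemma irreducible_closedinI_base:
  assumes "base_of Z L" "closedin Z F" "F \<noteq> {}"
    and meet: "\<And>U V. U \<in> L \<Longrightarrow> V \<in> L \<Longrightarrow> F \<inter> U \<noteq> {} \<Longrightarrow> F \<inter> V \<noteq> {} \<Longrightarrow> F \<inter> (U \<inter> V) \<noteq> {}"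
  shows "irreducible_closedin Z F"
  unfolding irreducible_closedin_def
proof (intro conjI allI impI)
  show "closedin Z F" "F \<noteq> {}" by fact+
  fix G H assume GH: "closedin Z G" "closedin Z H" "F = G \<union> H"
  show "F = G \<or> F = H"
  proof (rule ccontr)
    assume "\<not> ?thesis"
    then obtain x y where xy: "x \<in> F - G" "y \<in> F - H" using GH(3) by blast
    have "x \<in> topspace Z - G" "y \<in> topspace Z - H"
      using xy closedin_subset[OF assms(2)] by blast+
    moreover have "openin Z (topspace Z - G)" "openin Z (topspace Z - H)" using GH by blast+
    ultimately obtain U V where "U \<in> L" "x \<in> U" "U \<subseteq> topspace Z - G" "V \<in> L" "y \<in> V" "V \<subseteq> topspace Z - H"
      by (metis base_of_nbhd[OF assms(1)])
    then show False using meet[of U V] xy GH(3) by blast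
  qed
qed

lemma closure_of_sing_disjoint_open:
  assumes "x \<in> topspace Z" "openin Z U"
  shows "Z closure_of {x} \<inter> U = {} \<longleftrightarrow> x \<notin> U"
  using openin_Int_closure_of_eq_empty[OF assms(2), of "{x}"] by (simp add: Int_commute)

text \<open>A point of one closed set outside the other has a base neighbourhood that misses the
  other, so the base members missed by a closed set determine it.\<close>

lemma closedin_eqI_base:
  assumes base: "base_of Z L" and "closedin Z F" "closedin Z G"
    and disj: "\<And>U. U \<in> L \<Longrightarrow> F \<inter> U = {} \<longleftrightarrow> G \<inter> U = {}"
  shows "F = G"
proof -
  have sub: "G' \<subseteq> F'"
    if closed: "closedin Z F'" "closedin Z G'"
      and disj: "\<And>U. U \<in> L \<Longrightarrow> F' \<inter> U = {} \<Longrightarrow> G' \<inter> U = {}" for F' G'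
  proof
    fix x assume x: "x \<in> G'"
    show "x \<in> F'"
    proof (rule ccontr)
      assume "x \<notin> F'"
      then have "x \<in> topspace Z - F'" using x closedin_subset[OF closed(2)] by blast
      then obtain U where "U \<in> L" "x \<in> U" "U \<subseteq> topspace Z - F'"
        using base_of_nbhd[OF base] closed(1) by (metis closedin_def)
      then show False using disj[of U] x by blast
    qed
  qed
  show ?thesis using sub[of F G] sub[of G F] assms by blast
qed

text \<open>The base members missing \<open>F\<close> form a prime ideal, and the point representing
  it has closure \<open>F\<close>, because both closed sets miss the same members. Properness of
  \<open>F\<close> supplies a member in its complement, so that the ideal is non-empty.\<close>

lemma spectral_base_imp_almost_sober:
  assumes S: "spectral_base Z L"
  shows "almost_sober Z"
  unfolding almost_sober_def
proof (intro allI impI)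
  have L: "lattice_of_sets L" and base: "base_of Z L"
    and prime: "{I. lattice_prime_ideal (inclusion_order L) I} = point_ideal L ` topspace Z"
    using S unfolding spectral_base_def by auto
  fix F assume F: "irreducible_closedin Z F" and proper: "F \<noteq> topspace Z"
  then have cl: "closedin Z F" "F \<noteq> {}" unfolding irreducible_closedin_def by auto
  let ?I = "{U\<in>L. F \<inter> U = {}}"
  have "\<exists>x\<in>topspace Z. x \<notin> F" using proper closedin_subset[OF cl(1)] by blast
  then obtain U where "U \<in> L" "U \<subseteq> topspace Z - F"
    by (metis base_of_nbhd[OF base] cl(1) closedin_def DiffI)
  then have "?I \<noteq> {}" by blast
  moreover have "?I \<noteq> L"
  proof -
    obtain x where "x \<in> F" using cl by blast
    then have "x \<in> topspace Z" using closedin_subset[OF cl(1)] by blast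
    then obtain V where "V \<in> L" "x \<in> V" by (metis base_of_nbhd[OF base] openin_topspace)
    then show ?thesis using \<open>x \<in> F\<close> by blast
  qed
  moreover have "U \<in> ?I \<or> V \<in> ?I" if "U \<in> L" "V \<in> L" "U \<inter> V \<in> ?I" for U V
    using irreducible_closedin_Int_open[OF F base_of_openin[OF base] base_of_openin[OF base], of U V] that
    by blast
  moreover have "U \<union> V \<in> ?I" if "U \<in> ?I" "V \<in> ?I" for U V
    using that L by (auto simp: lattice_of_sets_def)
  ultimately have "lattice_prime_ideal (inclusion_order L) ?I"
    unfolding lattice_prime_ideal_inclusion_order[OF L] lattice_ideal_inclusion_order[OF L] by blast
  then obtain x where x: "x \<in> topspace Z" "?I = point_ideal L x" using prime by blast
  have "F = Z closure_of {x}"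
  proof (rule closedin_eqI_base[OF base cl(1) closedin_closure_of])
    fix U assume U: "U \<in> L"
    have "F \<inter> U = {} \<longleftrightarrow> x \<notin> U" using U x(2) unfolding point_ideal_def by blast
    then show "F \<inter> U = {} \<longleftrightarrow> Z closure_of {x} \<inter> U = {}"
      using closure_of_sing_disjoint_open[OF x(1) base_of_openin[OF base U]] by blast
  qed
  then show "\<exists>x\<in>topspace Z. F = Z closure_of {x}" using x(1) by blast
qed

lemma spectral_base_imp_down_spectral:
  assumes S: "spectral_base Z L" and "compact_space Z"
  shows "down_spectral Z"
proof -
  have "lattice_of_sets L" "base_of Z L"
    using S unfolding spectral_base_def by auto
  then have "coherent_space Z"
    unfolding coherent_space_def lattice_of_sets_def
    by (intro exI[of _ L]) (simp add: spectral_base_compactin[OF S])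
  then show ?thesis
    using assms spectral_base_imp_almost_sober[OF S]
    unfolding down_spectral_def spectral_base_def by simp
qed

section \<open>From a down-spectral space to a spectral base\<close>

lemma coherent_space_compact_open_Int:
  assumes "coherent_space Z" and U: "openin Z U" "compactin Z U" and V: "openin Z V" "compactin Z V"
  shows "compactin Z (U \<inter> V)"
proof -
  obtain B where B: "base_of Z B" "\<forall>U\<in>B. compactin Z U" "\<forall>U\<in>B. \<forall>V\<in>B. U \<inter> V \<in> B"
    using assms(1) unfolding coherent_space_def by blast
  \<comment> \<open>A compact open set is a finite union of members of the coherent base, so the
    intersection of two such sets is a finite union of pairwise intersections, each compact.\<close>
  have fin: "\<exists>\<F>. finite \<F> \<and> \<F> \<subseteq> B \<and> \<Union>\<F> = W" if W: "openin Z W" "compactin Z W" for W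
  proof -
    obtain B' where B': "B' \<subseteq> B" "\<Union>B' = W" using B(1) W(1) unfolding base_of_def by blast
    have "\<exists>\<F>. finite \<F> \<and> \<F> \<subseteq> B' \<and> W \<subseteq> \<Union>\<F>"
      using B' base_of_openin[OF B(1)] by (intro compactinD[OF W(2)]) auto
    then obtain \<F> where \<F>: "finite \<F>" "\<F> \<subseteq> B'" "W \<subseteq> \<Union>\<F>" by metis
    moreover have "\<Union>\<F> \<subseteq> W" using \<F>(2) B'(2) by blast
    ultimately show ?thesis using B'(1) by (intro exI[of _ \<F>]) auto
  qed
  obtain \<F> where \<F>: "finite \<F>" "\<F> \<subseteq> B" "\<Union>\<F> = U" using fin[OF U] by blast
  obtain \<G> where \<G>: "finite \<G>" "\<G> \<subseteq> B" "\<Union>\<G> = V" using fin[OF V] by blast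
  let ?H = "(\<lambda>(X, Y). X \<inter> Y) ` (\<F> \<times> \<G>)"
  have "finite ?H" using \<F>(1) \<G>(1) by blast
  moreover have "compactin Z X" if "X \<in> ?H" for X
    using that B(2,3) \<F>(2) \<G>(2) by (auto simp: subset_iff)
  ultimately have "compactin Z (\<Union>?H)" by (rule compactin_Union)
  moreover have "\<Union>?H = U \<inter> V" using \<F>(3) \<G>(3) by blast
  ultimately show ?thesis by simp
qed

text \<open>A prime ideal \<open>I\<close> corresponds to the closed complement \<open>F\<close> of
  its union. Primality makes \<open>F\<close> irreducible, and a generic point of \<open>F\<close>
  represents \<open>I\<close>. Almost-sobriety provides that point unless \<open>F\<close> is the
  whole space, the case for which \<open>L\<close> is adjusted.\<close>

lemma down_spectral_imp_spectral_base:
  assumes "down_spectral Z"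
  obtains L where "spectral_base Z L"
proof -
  have t0: "t0_space Z" and coh: "coherent_space Z" and comp: "compact_space Z"
    and sober: "almost_sober Z"
    using assms unfolding down_spectral_def by auto
  define generic where "generic \<longleftrightarrow> (\<exists>x\<in>topspace Z. topspace Z = Z closure_of {x})"
  define pointless where "pointless \<longleftrightarrow> irreducible_closedin Z (topspace Z) \<and> \<not> generic"
  define L where "L = {U. openin Z U \<and> compactin Z U \<and> (pointless \<longrightarrow> U \<noteq> {})}"
  have openL: "openin Z U" "compactin Z U" if "U \<in> L" for U
    using that unfolding L_def by auto
  \<comment> \<open>In an irreducible space non-empty open sets meet, so removing \<open>{}\<close>
    keeps \<open>L\<close> closed under intersection.\<close>
  have "U \<inter> V \<noteq> {}" if "pointless" "U \<in> L" "V \<in> L" for U V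
    using irreducible_closedin_Int_open[of Z "topspace Z" U V] that openin_subset
    unfolding pointless_def L_def by blast
  then have L: "lattice_of_sets L"
    using coherent_space_compact_open_Int[OF coh] compactin_Un
    unfolding lattice_of_sets_def L_def by auto
  have base: "base_of Z L"
    unfolding base_of_def
  proof (intro conjI ballI allI impI)
    obtain B where B: "base_of Z B" "\<forall>U\<in>B. compactin Z U"
      using coh unfolding coherent_space_def by blast
    fix W assume "openin Z W"
    then obtain B' where B': "B' \<subseteq> B" "\<Union>B' = W" using B(1) unfolding base_of_def by blast
    have "B' - {{}} \<subseteq> L" using B B' base_of_openin[OF B(1)] unfolding L_def by blast
    moreover have "\<Union>(B' - {{}}) = W" using B'(2) by blast
    ultimately show "\<exists>B'\<subseteq>L. \<Union>B' = W" by blast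
  qed (rule openL)
  \<comment> \<open>The space itself survives the removal of \<open>{}\<close>, since irreducibility
    includes being non-empty.\<close>
  have top: "topspace Z \<in> L"
    using comp unfolding L_def pointless_def compact_space_def irreducible_closedin_def by simp
  note ideal = lattice_ideal_inclusion_order[OF L]
  note prime = lattice_prime_ideal_inclusion_order[OF L]
  have "lattice_prime_ideal (inclusion_order L) I \<longleftrightarrow> I \<in> point_ideal L ` topspace Z" for I
  proof
    assume I: "lattice_prime_ideal (inclusion_order L) I"
    then have idl: "lattice_ideal (inclusion_order L) I" unfolding prime by blast
    then have I_sub: "I \<subseteq> L" and I_ne: "I \<noteq> {}" unfolding ideal by blast+
    \<comment> \<open>By compactness a member covered by \<open>I\<close> is covered by finitely
      many elements of \<open>I\<close>; thus \<open>I\<close> can be recovered from its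
      union.\<close>
    have mem: "U \<in> I" if "U \<in> L" "U \<subseteq> \<Union>I" for U
    proof -
      have "\<exists>\<F>. finite \<F> \<and> \<F> \<subseteq> I \<and> U \<subseteq> \<Union>\<F>"
        using that(2) I_sub openL(1) by (intro compactinD[OF openL(2)[OF that(1)]]) auto
      then show ?thesis
        using lattice_ideal_inclusion_order_Union_finite[OF L idl that(1)] by metis
    qed
    define F where "F = topspace Z - \<Union>I"
    have disj: "F \<inter> U = {} \<longleftrightarrow> U \<in> I" if "U \<in> L" for U
      using mem[OF that] openin_subset[OF openL(1)[OF that]] unfolding F_def by blast
    have closed: "closedin Z F"
      unfolding F_def using I_sub openL by (intro closedin_diff openin_Union) auto
    have irr: "irreducible_closedin Z F"
    proof (rule irreducible_closedinI_base[OF base closed])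
      show "F \<noteq> {}"
      proof
        assume "F = {}"
        then have "I = L" using disj I_sub by blast
        then show False using I unfolding prime by blast
      qed
      fix U V assume UV: "U \<in> L" "V \<in> L" "F \<inter> U \<noteq> {}" "F \<inter> V \<noteq> {}"
      have "U \<inter> V \<in> L" using UV L unfolding lattice_of_sets_def by blast
      moreover have "U \<inter> V \<notin> I" using I UV disj unfolding prime by blast
      ultimately show "F \<inter> (U \<inter> V) \<noteq> {}" using disj by blast
    qed
    have "\<exists>x\<in>topspace Z. F = Z closure_of {x}"
    proof (cases "F = topspace Z")
      case True
      \<comment> \<open>Here the union of \<open>I\<close> is empty, so \<open>{}\<close> lies in
        \<open>I\<close> and hence in \<open>L\<close>. By the choice of \<open>L\<close> the
        irreducible space then has a generic point.\<close>
      then have "\<Union>I \<inter> topspace Z = {}" unfolding F_def by blast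
      moreover obtain U where U: "U \<in> I" using I_ne by blast
      moreover have "U \<subseteq> topspace Z" using U I_sub openin_subset[OF openL(1)] by blast
      ultimately have "U = {}" by blast
      then have "{} \<in> L" using U I_sub by blast
      then have "\<not> pointless" unfolding L_def by blast
      then show ?thesis using True irr unfolding pointless_def generic_def by blast
    next
      case False
      then show ?thesis using sober irr unfolding almost_sober_def by blast
    qed
    then obtain x where x: "x \<in> topspace Z" "F = Z closure_of {x}" by blast
    have "U \<in> I \<longleftrightarrow> x \<notin> U" if "U \<in> L" for U
      using disj[OF that] closure_of_sing_disjoint_open[OF x(1) openL(1)[OF that]] x(2) by blast
    then have "I = point_ideal L x" using I_sub unfolding point_ideal_def by blast
    then show "I \<in> point_ideal L ` topspace Z" using x(1) by blast
  next
    assume "I \<in> point_ideal L ` topspace Z"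
    then obtain x where x: "x \<in> topspace Z" "I = point_ideal L x" by blast
    \<comment> \<open>The point ideal must be non-empty. When \<open>{}\<close> has been left out,
      \<open>x\<close> is not generic, and a base member in the complement of its closure serves
      instead.\<close>
    have "\<exists>U\<in>L. x \<notin> U"
    proof (cases pointless)
      case True
      then have "Z closure_of {x} \<noteq> topspace Z"
        using x(1) unfolding pointless_def generic_def by blast
      then obtain y where "y \<in> topspace Z - Z closure_of {x}"
        using closure_of_subset_topspace[of Z "{x}"] by blast
      then obtain U where U: "U \<in> L" "U \<subseteq> topspace Z - Z closure_of {x}"
        by (metis base_of_nbhd[OF base] closedin_closure_of closedin_def)
      then show ?thesis using closure_of_sing_disjoint_open[OF x(1) openL(1)[OF U(1)]] by blast
    next
      case False
      then have "{} \<in> L" unfolding L_def by simp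
      then show ?thesis by blast
    qed
    then have "I \<noteq> {}" "I \<noteq> L" using top x unfolding point_ideal_def by blast+
    then show "lattice_prime_ideal (inclusion_order L) I"
      using L unfolding prime ideal x(2) point_ideal_def lattice_of_sets_def by blast
  qed
  then have "spectral_base Z L"
    using L base t0 top unfolding spectral_base_def by blast
  then show ?thesis by (rule that)
qed

section \<open>Balbes-Dwinger spaces\<close>

text \<open>The carrier type \<open>'b\<close> disappears here: the abstract lattice is replaced by
  its image among the open sets of \<open>Z\<close>.\<close>

lemma balbes_dwinger_space_imp_spectral_base:
  assumes "balbes_dwinger_space TYPE('b) Z"
  shows "\<exists>L. spectral_base Z L"
proof -
  obtain M :: "'b gorder" and f where "lattice M" "carrier M \<noteq> {}" "homeomorphic_map Z (prime_spectrum M) f"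
    using assms unfolding balbes_dwinger_space_def distributive_lattice_def homeomorphic_space
    by blast
  then show ?thesis using spectral_base_of_homeomorphic_map by blast
qed

lemma balbes_dwinger_space_iff:
  fixes Z :: "'a topology"
  shows "balbes_dwinger_space TYPE('a set) Z \<longleftrightarrow> (\<exists>L. spectral_base Z L)"
proof
  assume "\<exists>L. spectral_base Z L"
  then obtain L where L: "spectral_base Z L" ..
  then have "distributive_lattice (inclusion_order L)"
    unfolding spectral_base_def by (blast intro: distributive_lattice_inclusion_order)
  then show "balbes_dwinger_space TYPE('a set) Z"
    using spectral_base_homeomorphic[OF L] unfolding balbes_dwinger_space_def by blast
qed (rule balbes_dwinger_space_imp_spectral_base)

text \<open>A proper ideal cannot contain the maximum \<open>m\<close>, so \<open>m\<close> is
  mapped to the whole space, which is thereby a base member and hence compact.\<close>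

lemma spectrum_of_lattice_with_max_imp:
  assumes "spectrum_of_lattice_with_max TYPE('b) Z"
  shows "balbes_dwinger_space TYPE('b) Z \<and> compact_space Z"
proof -
  obtain M :: "'b gorder" and m f where M: "distributive_lattice M" and m: "greatest M m (carrier M)"
    and f: "homeomorphic_map Z (prime_spectrum M) f"
    using assms unfolding spectrum_of_lattice_with_max_def homeomorphic_space by blast
  let ?u = "\<lambda>a. {x \<in> topspace Z. a \<notin> f x}"
  have S: "spectral_base Z (?u ` carrier M)"
    using M spectral_base_of_homeomorphic_map[OF _ _ f] unfolding distributive_lattice_def by blast
  have "m \<notin> I" if "lattice_prime_ideal M I" for I
    using that m unfolding lattice_prime_ideal_def lattice_ideal_def greatest_def by blast
  moreover have "lattice_prime_ideal M (f x)" if "x \<in> topspace Z" for x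
    using that f unfolding homeomorphic_eq_everything_map topspace_prime_spectrum by blast
  ultimately have "?u m = topspace Z" by blast
  then have "topspace Z \<in> ?u ` carrier M" using m unfolding greatest_def by blast
  then have "compact_space Z" using spectral_base_compact_space_iff[OF S] by blast
  then show ?thesis
    using M homeomorphic_map_imp_homeomorphic_space[OF f] unfolding balbes_dwinger_space_def by blast
qed

lemma spectral_base_imp_spectrum_of_lattice_with_max:
  fixes Z :: "'a topology"
  assumes L: "spectral_base Z L" and "compact_space Z"
  shows "spectrum_of_lattice_with_max TYPE('a set) Z"
proof -
  have "U \<subseteq> topspace Z" if "U \<in> L" for U
    using L that base_of_openin openin_subset unfolding spectral_base_def by metis
  then have "greatest (inclusion_order L) (topspace Z) (carrier (inclusion_order L))"
    using spectral_base_topspace_mem[OF assms] unfolding greatest_def by auto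
  moreover have "distributive_lattice (inclusion_order L)"
    using L unfolding spectral_base_def by (blast intro: distributive_lattice_inclusion_order)
  ultimately show ?thesis
    using spectral_base_homeomorphic[OF L] unfolding spectrum_of_lattice_with_max_def by blast
qed

text \<open>The last two conjuncts justify the fixed type \<open>'a set\<close>: a lattice over any
  other type \<open>'b\<close> can be replaced by one of sets of points of \<open>Z\<close>.\<close>

theorem corollary3:
  fixes Z :: "'a topology"
  shows "(down_spectral Z \<longleftrightarrow> balbes_dwinger_space TYPE('a set) Z \<and> compact_space Z) \<and>
         (down_spectral Z \<longleftrightarrow> spectrum_of_lattice_with_max TYPE('a set) Z) \<and>
         (balbes_dwinger_space TYPE('b) Z \<longrightarrow> balbes_dwinger_space TYPE('a set) Z) \<and>
         (spectrum_of_lattice_with_max TYPE('b) Z \<longrightarrow> spectrum_of_lattice_with_max TYPE('a set) Z)"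
proof -
  have down: "down_spectral Z \<longleftrightarrow> (\<exists>L. spectral_base Z L) \<and> compact_space Z"
    using spectral_base_imp_down_spectral down_spectral_imp_spectral_base
    unfolding down_spectral_def by metis
  show ?thesis
    using down balbes_dwinger_space_iff[of Z] balbes_dwinger_space_imp_spectral_base[of Z, where 'b='b]
      spectrum_of_lattice_with_max_imp[of Z, where 'b='b]
      spectrum_of_lattice_with_max_imp[of Z, where 'b="'a set"]
      spectral_base_imp_spectrum_of_lattice_with_max[of Z]
    by blast
qed

end
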